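(* Let $r$ be a positive integer and $p$ a prime. Then $p_{b(r)+1}^2\notin F_r$ and $p^3\notin F_r$.
   Context: $p_i$ denotes the $i$-th prime. For a positive integer $r$, $S_r$ is the multiplicative arithmetic function with $S_r(q^{\alpha})=0$ if $q\leq r$ and $S_r(q^{\alpha})=q^{\alpha-1}(q-r)$ if $q>r$, for all primes $q$ and positive integers $\alpha$. $B_r=\{n\in\mathbb{N}: S_r(n)>0\}$ (positive integers whose smallest prime factor exceeds $r$, together with $1$). $F_r$ is the set of $n\in B_r$ such that $S_r(n)<S_r(m)$ for all $m\in B_r$ with $m>n$. $b(1)=0$, and for $r\geq 2$, $b(r)$ is the largest integer with $p_{b(r)}\leq r$. *)

theory Defs
  imports "HOL-Computational_Algebra.Primes"
begin

definition nth_prime1 :: "nat \<Rightarrow> nat" where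
  "nth_prime1 i = (LEAST p. prime p \<and> card {q. prime q \<and> q \<le> p} = i)"

definition S :: "nat \<Rightarrow> nat \<Rightarrow> nat" where
  "S r n = (\<Prod>q\<in>prime_factors n.
      (if q \<le> r then 0 else q ^ (multiplicity q n - 1) * (q - r)))"

definition B :: "nat \<Rightarrow> nat set" where
  "B r = {n. n \<ge> 1 \<and> S r n > 0}"

definition F :: "nat \<Rightarrow> nat set" where
  "F r = {n \<in> B r. \<forall>m \<in> B r. m > n \<longrightarrow> S r n < S r m}"

definition b :: "nat \<Rightarrow> nat" where
  "b r = (if r = 1 then 0 else (GREATEST k. k \<ge> 1 \<and> nth_prime1 k \<le> r))"

end

theory Submission
  imports Complex_Main "HOL-Library.Discrete_Functions" Defs
begin

text \<open>
  Let \<open>q\<close> be the least prime exceeding \<open>r\<close>. A sharpening of Bertrand's postulate, giving two primes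
  in \<open>(n, 2 n + 1]\<close> for every \<open>n \<ge> 1\<close>, yields \<open>q \<le> 2 r\<close> and a prime \<open>z\<close> with \<open>q < z \<le> q + r\<close>.
  Replacing one factor \<open>q\<close> of \<open>q\<^sup>2\<close> or \<open>q\<^sup>3\<close> by \<open>z\<close> gives a larger number at which \<open>S r\<close> is not
  larger, because \<open>z - r \<le> q\<close>. For a prime \<open>p > q\<close> the cube \<open>p\<^sup>3\<close> is beaten by \<open>q p y\<close>, where \<open>y\<close> is a
  Bertrand prime with \<open>p\<^sup>2 div q < y \<le> 2 (p\<^sup>2 div q)\<close>: then \<open>q y > p\<^sup>2\<close>, while
  \<open>(q - r) y \<le> p\<^sup>2\<close> since \<open>2 (q - r) \<le> q\<close>.

  The two primes come from Erdos' proof of Bertrand's postulate: if \<open>(n, 2 n]\<close> contained at most one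
  prime, the central binomial coefficient would be too small once \<open>n \<ge> 648\<close>.
\<close>

subsection \<open>Prime factors of the central binomial coefficient\<close>

lemma multiplicity_eq_card_power_dvd:
  fixes p n N :: nat
  assumes "prime p" "n > 0" "n < p ^ N"
  shows "multiplicity p n = card {k \<in> {1..N}. p ^ k dvd n}"
proof -
  have dvd_iff: "p ^ k dvd n \<longleftrightarrow> k \<le> multiplicity p n" for k
    using assms by (intro power_dvd_iff_le_multiplicity) auto
  have "\<not> p ^ N dvd n"
    using assms by (auto dest: dvd_imp_le)
  then have "multiplicity p n < N"
    by (simp add: dvd_iff)
  then have "{k \<in> {1..N}. p ^ k dvd n} = {1..multiplicity p n}"
    by (auto simp: dvd_iff)
  then show ?thesis by simp
qed

text \<open>Legendre's formula, cut off at any \<open>N\<close> beyond which all terms vanish.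
  Passing from \<open>n\<close> to \<open>n + 1\<close> raises \<open>n div p ^ k\<close> by one
  exactly when \<open>p ^ k\<close> divides \<open>n + 1\<close>.\<close>

lemma legendre_multiplicity_fact:
  fixes p n N :: nat
  assumes "prime p" "n < p ^ N"
  shows "multiplicity p (fact n) = (\<Sum>k=1..N. n div p ^ k)"
  using assms(2)
proof (induction n)
  case (Suc n)
  have "multiplicity p (fact (Suc n)) = multiplicity p (Suc n) + multiplicity p (fact n)"
    using assms(1) by (simp add: prime_elem_multiplicity_mult_distrib del: mult_Suc)
  also have "multiplicity p (Suc n) = (\<Sum>k=1..N. if p ^ k dvd Suc n then 1 else 0)"
    using multiplicity_eq_card_power_dvd[of p "Suc n" N] assms(1) Suc.prems
    by (simp add: sum.If_cases Int_def)
  also have "multiplicity p (fact n) = (\<Sum>k=1..N. n div p ^ k)"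
    using Suc by simp
  also have "(\<Sum>k=1..N. if p ^ k dvd Suc n then 1 else 0) + (\<Sum>k=1..N. n div p ^ k)
      = (\<Sum>k=1..N. Suc n div p ^ k)"
    unfolding sum.distrib[symmetric]
    by (intro sum.cong) (auto simp: div_Suc dvd_eq_mod_eq_0)
  finally show ?case .
qed auto

lemma multiplicity_central_binomial:
  fixes p n N :: nat
  assumes "prime p" "2 * n < p ^ N"
  shows "multiplicity p ((2 * n) choose n) = (\<Sum>k=1..N. (2 * n) div p ^ k - 2 * (n div p ^ k))"
proof -
  have "(fact (2 * n) :: nat) = fact n * fact n * ((2 * n) choose n)"
    using binomial_fact_lemma[of n "2 * n"] by (simp add: mult_2)
  then have "multiplicity p (fact (2 * n) :: nat) =
      2 * multiplicity p (fact n :: nat) + multiplicity p ((2 * n) choose n)"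
    using assms(1) by (simp add: prime_elem_multiplicity_mult_distrib)
  moreover have "n < p ^ N" using assms(2) by simp
  \<comment> \<open>This keeps the natural-number subtraction from truncating, so the sum of
    differences splits.\<close>
  moreover have "2 * (n div p ^ k) \<le> (2 * n) div p ^ k" for k
    using prime_gt_0_nat[OF assms(1)]
    by (simp add: less_eq_div_iff_mult_less_eq mult.assoc)
  then have "(\<Sum>k=1..N. (2 * n) div p ^ k - 2 * (n div p ^ k)) =
      (\<Sum>k=1..N. (2 * n) div p ^ k) - (\<Sum>k=1..N. 2 * (n div p ^ k))"
    by (intro sum_subtractf_nat) auto
  ultimately show ?thesis
    using legendre_multiplicity_fact[OF assms(1), of n N] legendre_multiplicity_fact[OF assms]
    by (simp add: sum_distrib_left)
qed

text \<open>Every term of the Legendre sum is 0 or 1. If \<open>p ^ ?v\<close> exceeded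
  \<open>2 * n\<close>, then \<open>?v\<close> itself could serve as the cutoff and the term at
  \<open>k = ?v\<close> would vanish, leaving a sum of at most \<open>?v - 1\<close>.\<close>

lemma prime_power_multiplicity_central_binomial_le:
  fixes p n :: nat
  assumes "prime p" "n > 0"
  shows "p ^ multiplicity p ((2 * n) choose n) \<le> 2 * n"
proof (rule ccontr)
  let ?v = "multiplicity p ((2 * n) choose n)"
  assume "\<not> ?thesis"
  then have big: "2 * n < p ^ ?v" by simp
  have p: "p > 1" using assms(1) prime_gt_1_nat by blast
  have v: "?v > 0" using big assms(2) by (intro gr0I) auto
  have "?v = (\<Sum>k=1..?v. (2 * n) div p ^ k - 2 * (n div p ^ k))"
    using multiplicity_central_binomial[OF assms(1) big] .
  also have "\<dots> \<le> (\<Sum>k=1..?v. if k = ?v then 0 else 1)"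
  proof (intro sum_mono)
    fix k assume "k \<in> {1..?v}"
    have "(2 * n) div p ^ k < 2 * (n div p ^ k) + 2"
    proof -
      have pk: "p ^ k > 0" using p by simp
      have "n < (n div p ^ k + 1) * p ^ k"
        using dividend_less_div_times[OF pk, of n] by simp
      then have "2 * n < (2 * (n div p ^ k) + 2) * p ^ k" by simp
      then show ?thesis using pk by (simp add: less_mult_imp_div_less)
    qed
    then show "(2 * n) div p ^ k - 2 * (n div p ^ k) \<le> (if k = ?v then 0 else 1)"
      using big by auto
  qed
  also have "\<dots> = card ({1..?v} - {?v})"
    by (simp add: sum.If_cases Diff_eq)
  also have "\<dots> < ?v" using v by simp
  finally show False by simp
qed

text \<open>In this range only the terms for \<open>p\<close> itself survive: two multiples of
  \<open>p\<close> in \<open>(2 * n)!\<close> cancel against one in each copy of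
  \<open>n!\<close>.\<close>

lemma multiplicity_central_binomial_eq_0:
  fixes p n :: nat
  assumes "prime p" "2 * n < 3 * p" "p \<le> n" "2 * n < p ^ 2"
  shows "multiplicity p ((2 * n) choose n) = 0"
proof -
  have "n div p = 1" using assms by (intro div_nat_eqI) auto
  moreover have "(2 * n) div p = 2" using assms by (intro div_nat_eqI) auto
  moreover have "{1..2::nat} = {1, 2}" by auto
  ultimately show ?thesis
    using multiplicity_central_binomial[OF assms(1,4)] assms by simp
qed

section \<open>Chebyshev-type bound on the product of the primes up to n\<close>

lemma prod_primes_dvd:
  fixes m :: nat
  assumes "finite A" "\<And>q. q \<in> A \<Longrightarrow> prime q" "\<And>q. q \<in> A \<Longrightarrow> q dvd m" "m > 0"
  shows "\<Prod>A dvd m"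
proof (rule multiplicity_le_imp_dvd)
  show "\<Prod>A \<noteq> 0"
    using assms(1) assms(2)[of 0] by auto
  fix p :: nat assume "prime p"
  then show "multiplicity p (\<Prod>A) \<le> multiplicity p m"
    using multiplicity_prod_prime_powers[OF assms(1,2), of p "\<lambda>_. 1"] assms
    by (auto simp: Suc_le_eq prime_multiplicity_gt_zero_iff)
qed

text \<open>Two equal middle entries share a row of total \<open>2 * 4 ^ m\<close>.\<close>

lemma binomial_odd_middle_le: "(2 * m + 1) choose m \<le> 4 ^ m"
proof -
  have "2 * ((2 * m + 1) choose m) = ((2 * m + 1) choose m) + ((2 * m + 1) choose (m + 1))"
    using central_binomial_odd[of "2 * m + 1"] by simp
  also have "\<dots> = sum ((choose) (2 * m + 1)) {m, m + 1}" by simp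
  also have "\<dots> \<le> sum ((choose) (2 * m + 1)) {..2 * m + 1}"
    by (intro sum_mono2) auto
  also have "\<dots> = 2 * 4 ^ m" 
    by (simp add: choose_row_sum power_mult del: sum.atMost_Suc binomial_Suc_Suc)
  finally show ?thesis by simp
qed

text \<open>An even \<open>n > 2\<close> adds no prime. For \<open>n = 2 * m + 1\<close> the primes
  above \<open>m + 1\<close> all divide \<open>(2 * m + 1) choose m\<close>, which is at most
  \<open>4 ^ m\<close>; the others fall under the induction hypothesis at
  \<open>m + 1\<close>.\<close>

lemma primorial_le: "\<Prod>{p. prime p \<and> p \<le> n} \<le> (4::nat) ^ n"
proof (induction n rule: less_induct)
  case (less n)
  consider "n \<le> 1" | "n = 2" | "n > 2" "even n" | m where "n = 2 * m + 1" "m > 0"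
    by (metis One_nat_def add.left_neutral gr0I le_eq_less_or_eq less_2_cases_iff linorder_neqE_nat
        mult_0_right oddE)
  then show ?case
  proof cases
    case 1
    then have "\<not> (prime p \<and> p \<le> n)" for p
      using prime_gt_1_nat[of p] by linarith
    then have empty: "{p. prime p \<and> p \<le> n} = {}" by blast
    show ?thesis unfolding empty by simp
  next
    case 2
    have "{p::nat. prime p \<and> p \<le> 2} = {2}"
      using prime_ge_2_nat by (auto simp: le_antisym)
    then show ?thesis by (simp add: 2)
  next
    case 3
    then have "\<not> prime n" using prime_odd_nat by blast
    then have "prime p \<and> p \<le> n \<longleftrightarrow> prime p \<and> p \<le> n - 1" for p
      by (cases "p = n") auto
    then have "{p. prime p \<and> p \<le> n} = {p. prime p \<and> p \<le> n - 1}" by simp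
    then have "\<Prod>{p. prime p \<and> p \<le> n} \<le> 4 ^ (n - 1)"
      using less[of "n - 1"] 3 by simp
    also have "\<dots> \<le> 4 ^ n" by simp
    finally show ?thesis .
  next
    case 4
    let ?A = "{p. prime p \<and> p \<le> m + 1}" and ?B = "{p. prime p \<and> m + 1 < p \<and> p \<le> n}"
    have "\<Prod>?B dvd (2 * m + 1) choose m"
    proof (rule prod_primes_dvd)
      fix q assume q: "q \<in> ?B"
      have "fact m * fact (m + 1) * ((2 * m + 1) choose m) = (fact (2 * m + 1) :: nat)"
        using binomial_fact_lemma[of m "2 * m + 1"] by (simp add: mult_2)
      moreover have "q dvd fact (2 * m + 1)" "\<not> q dvd fact m" "\<not> q dvd fact (m + 1)"
        using q 4 by (auto simp: prime_dvd_fact_iff simp del: fact_Suc)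
      ultimately show "q dvd (2 * m + 1) choose m"
        using q by (metis (no_types, lifting) mem_Collect_eq prime_dvd_mult_iff)
    qed auto
    then have "\<Prod>?B \<le> (2 * m + 1) choose m"
      by (intro dvd_imp_le) auto
    also have "\<dots> \<le> 4 ^ m" by (rule binomial_odd_middle_le)
    finally have B: "\<Prod>?B \<le> 4 ^ m" .
    have "{p. prime p \<and> p \<le> n} = ?A \<union> ?B" using 4 by auto
    then have "\<Prod>{p. prime p \<and> p \<le> n} = \<Prod>?A * \<Prod>?B"
      by (simp only:, intro prod.union_disjoint) auto
    also have "\<dots> \<le> 4 ^ (m + 1) * 4 ^ m"
      using less[of "m + 1"] 4 B by (intro mult_le_mono) auto
    also have "\<dots> = 4 ^ n" by (simp add: 4 power_add mult_2)
    finally show ?thesis .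
  qed
qed

section \<open>Size estimates for the central binomial coefficient\<close>

lemma central_binomial_lower_bound_nat:
  assumes "n > 0" shows "4 ^ n \<le> 2 * n * ((2 * n) choose n)"
proof -
  have "real (4 ^ n) \<le> real (2 * n * ((2 * n) choose n))"
    using central_binomial_lower_bound[OF assms] assms by (simp add: field_simps)
  then show ?thesis by (simp only: of_nat_le_iff)
qed

lemma sixth_power_less_two_power:
  fixes s :: nat
  assumes "s \<ge> 36" shows "(s + 1) ^ 6 < 2 ^ (s - 2)"
  using assms
proof (induction s rule: dec_induct)
  case (step s)
  \<comment> \<open>From \<open>s\<close> to \<open>s + 1\<close> the left side grows by a factor of
    at most \<open>(38 / 37) ^ 6 < 2\<close>, while the right side doubles.\<close>
  have "(1 + 1 / real (s + 1)) ^ 6 \<le> (1 + 1 / 37) ^ 6"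
    using step by (intro power_mono) (auto simp: field_simps)
  also have "\<dots> \<le> 2" by (simp add: power_divide)
  finally have "(1 + 1 / real (s + 1)) ^ 6 * real (s + 1) ^ 6 \<le> 2 * real (s + 1) ^ 6"
    by (intro mult_right_mono) auto
  also have "(1 + 1 / real (s + 1)) ^ 6 * real (s + 1) ^ 6 = real (s + 2) ^ 6"
    unfolding power_mult_distrib[symmetric] by (simp add: distrib_right)
  finally have "real ((s + 2) ^ 6) \<le> real (2 * (s + 1) ^ 6)" by simp
  then have "(s + 2) ^ 6 \<le> 2 * (s + 1) ^ 6" by (simp only: of_nat_le_iff)
  also have "\<dots> < 2 * 2 ^ (s - 2)" using step by simp
  also have "\<dots> = 2 ^ (Suc s - 2)"
    using step by (simp flip: power_Suc add: Suc_diff_le)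
  finally show ?case by simp
qed simp

lemma central_binomial_eq_prod_primes:
  "(2 * n) choose n = (\<Prod>p | prime p \<and> p \<le> 2 * n. p ^ multiplicity p ((2 * n) choose n))"
proof -
  let ?C = "(2 * n) choose n"
  have "p \<le> 2 * n" if "prime p" "p dvd ?C" for p
  proof -
    have "(fact (2 * n) :: nat) = fact n * fact n * ?C"
      using binomial_fact_lemma[of n "2 * n"] by (simp add: mult_2)
    then have "p dvd fact (2 * n)" using that(2) by simp
    then show ?thesis using that(1) by (simp add: prime_dvd_fact_iff)
  qed
  then have "prime_factors ?C \<subseteq> {p. prime p \<and> p \<le> 2 * n}"
    by (auto simp: prime_factors_dvd)
  then have "(\<Prod>p\<in>prime_factors ?C. p ^ multiplicity p ?C) =
      (\<Prod>p | prime p \<and> p \<le> 2 * n. p ^ multiplicity p ?C)"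
    by (intro prod.mono_neutral_left) (auto simp: prime_factors_multiplicity)
  then show ?thesis
    using prime_factorization_nat[of ?C] by simp
qed

text \<open>The primes are split at \<open>s\<close>, the integer square root of
  \<open>2 * n\<close>, and at \<open>n\<close>. Each of the at most \<open>s\<close> small primes
  contributes at most \<open>2 * n\<close>. Those in \<open>(s, n]\<close> occur at most once, and
  not at all beyond \<open>2 * n div 3\<close>, so the primorial bound applies. Those above
  \<open>n\<close> are only counted.\<close>

lemma central_binomial_upper_bound:
  fixes n s :: nat
  assumes "n \<ge> 5" "s\<^sup>2 \<le> 2 * n" "2 * n < (s + 1)\<^sup>2"
  shows "(2 * n) choose n \<le>
    (2 * n) ^ s * 4 ^ (2 * n div 3) * (2 * n) ^ card {p. prime p \<and> n < p \<and> p \<le> 2 * n}"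
proof -
  let ?C = "(2 * n) choose n"
  let ?g = "\<lambda>p. p ^ multiplicity p ?C"
  let ?A = "{p. prime p \<and> p \<le> s}" and ?M = "{p. prime p \<and> s < p \<and> p \<le> n}"
    and ?P = "{p. prime p \<and> n < p \<and> p \<le> 2 * n}"
  have g_le: "?g p \<le> 2 * n" if "prime p" for p
    using prime_power_multiplicity_central_binomial_le[OF that, of n] assms(1) by simp
  have "s \<le> n"
  proof (rule ccontr)
    assume "\<not> s \<le> n"
    then have "(n + 1) * (n + 1) \<le> s\<^sup>2" unfolding power2_eq_square by (intro mult_le_mono) auto
    then show False using assms(2) by simp
  qed
  then have "{p. prime p \<and> p \<le> 2 * n} = ?A \<union> (?M \<union> ?P)" by auto
  then have "?C = prod ?g (?A \<union> (?M \<union> ?P))"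
    using central_binomial_eq_prod_primes[of n] by simp
  also have "\<dots> = prod ?g ?A * prod ?g (?M \<union> ?P)"
    using \<open>s \<le> n\<close> by (intro prod.union_disjoint) auto
  also have "prod ?g (?M \<union> ?P) = prod ?g ?M * prod ?g ?P"
    by (intro prod.union_disjoint) auto
  finally have C: "?C = prod ?g ?A * prod ?g ?M * prod ?g ?P" by simp
  have "prod ?g ?A \<le> (\<Prod>p\<in>?A. 2 * n)"
    using g_le by (intro prod_mono) auto
  also have "\<dots> = (2 * n) ^ card ?A" by simp
  also have "\<dots> \<le> (2 * n) ^ s"
  proof (rule power_increasing)
    have "card ?A \<le> card {1..s}"
      by (intro card_mono) (auto simp: Suc_le_eq prime_gt_0_nat)
    then show "card ?A \<le> s" by simp
  qed (use assms in auto)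
  finally have A: "prod ?g ?A \<le> (2 * n) ^ s" .
  have "prod ?g ?P \<le> (\<Prod>p\<in>?P. 2 * n)"
    using g_le by (intro prod_mono) auto
  then have P: "prod ?g ?P \<le> (2 * n) ^ card ?P" by simp
  have "prod ?g ?M \<le> (\<Prod>p\<in>?M. if p \<le> 2 * n div 3 then p else 1)"
  proof (intro prod_mono conjI)
    fix p assume "p \<in> ?M"
    then have p: "prime p" "s < p" "p \<le> n" by auto
    have "(s + 1)\<^sup>2 \<le> p\<^sup>2" using p by (intro power_mono) auto
    then have sq: "2 * n < p\<^sup>2" using assms(3) by linarith
    show "?g p \<le> (if p \<le> 2 * n div 3 then p else 1)"
    proof (cases "p \<le> 2 * n div 3")
      case True
      have "p ^ multiplicity p ?C < p ^ 2"
        using g_le[OF p(1)] sq by linarith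
      then have "multiplicity p ?C < 2"
        using p(1) prime_gt_1_nat power_less_imp_less_exp by blast
      then have "p ^ multiplicity p ?C \<le> p ^ 1"
        using p(1) prime_ge_1_nat by (intro power_increasing) auto
      then show ?thesis using True by simp
    next
      case False
      then have "multiplicity p ?C = 0"
        using p sq by (intro multiplicity_central_binomial_eq_0) auto
      then show ?thesis using False by simp
    qed
  qed auto
  also have "\<dots> = \<Prod>{p \<in> ?M. p \<le> 2 * n div 3}"
    by (subst prod.inter_filter) auto
  also have "\<dots> \<le> \<Prod>{p. prime p \<and> p \<le> 2 * n div 3}"
    by (intro dvd_imp_le prod_dvd_prod_subset) (auto intro!: prod_pos simp: prime_gt_0_nat)
  also have "\<dots> \<le> 4 ^ (2 * n div 3)" by (rule primorial_le)
  finally have M: "prod ?g ?M \<le> 4 ^ (2 * n div 3)" .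
  show ?thesis by (rule ord_eq_le_trans[OF C]) (intro mult_le_mono A M P)
qed

subsection \<open>Two primes in a Bertrand interval\<close>

lemma card_primes_gt_le_double:
  fixes n :: nat
  assumes "n \<ge> 648"
  shows "card {p. prime p \<and> n < p \<and> p \<le> 2 * n} \<ge> 2"
proof (rule ccontr)
  let ?P = "{p. prime p \<and> n < p \<and> p \<le> 2 * n}"
  assume "\<not> ?thesis"
  then have card: "card ?P \<le> 1" by simp
  define s where "s = floor_sqrt (2 * n)"
  have s: "s\<^sup>2 \<le> 2 * n" "2 * n < (s + 1)\<^sup>2"
    using Suc_floor_sqrt_power2_gt[of "2 * n"] by (simp_all add: s_def)
  have "s \<ge> 36"
  \<comment> \<open>The threshold 648 is \<open>36^2 / 2\<close>.\<close>
  proof (rule ccontr)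
    assume "\<not> s \<ge> 36"
    then have "(s + 1)\<^sup>2 \<le> 36\<^sup>2" by (intro power_mono) auto
    then show False using s(2) assms by simp
  qed
  have "4 ^ n \<le> 2 * n * ((2 * n) choose n)"
    using assms by (intro central_binomial_lower_bound_nat) auto
  also have "\<dots> \<le> 2 * n * ((2 * n) ^ s * 4 ^ (2 * n div 3) * (2 * n) ^ card ?P)"
    using central_binomial_upper_bound[OF _ s] assms by (intro mult_le_mono2) simp
  also have "\<dots> \<le> 2 * n * ((2 * n) ^ s * 4 ^ (2 * n div 3) * (2 * n) ^ 1)"
    using card assms by (intro mult_le_mono2 power_increasing) auto
  also have "\<dots> = (2 * n) ^ (s + 2) * 4 ^ (2 * n div 3)"
    by (simp add: power2_eq_square)
  \<comment> \<open>Cubing removes the rounding in \<open>2 * n div 3\<close>; cancelling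
    \<open>4 ^ (2 * n)\<close> then leaves \<open>4 ^ n\<close> on the left.\<close>
  finally have "(4 ^ n) ^ 3 \<le> ((2 * n) ^ (s + 2) * 4 ^ (2 * n div 3)) ^ 3"
    by (rule power_mono) simp
  also have "\<dots> = (2 * n) ^ (3 * (s + 2)) * 4 ^ (3 * (2 * n div 3))"
    by (simp only: power_mult_distrib power_mult[symmetric] mult.commute)
  also have "\<dots> \<le> (2 * n) ^ (3 * (s + 2)) * 4 ^ (2 * n)"
    by (intro mult_le_mono2 power_increasing) auto
  also have "(4 ^ n) ^ 3 = (4::nat) ^ n * 4 ^ (2 * n)"
    by (simp add: power_mult[symmetric] power_add[symmetric])
  finally have "4 ^ n \<le> (2 * n) ^ (3 * (s + 2))" by simp
  also have "\<dots> \<le> ((s + 1)\<^sup>2) ^ (3 * (s + 2))"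
    using s(2) by (intro power_mono) auto
  also have "\<dots> = ((s + 1) ^ 6) ^ (s + 2)"
    by (simp only: power_mult[symmetric] mult.assoc[symmetric]) simp
  \<comment> \<open>The exponent \<open>s - 2\<close> is chosen so that its product with
    \<open>s + 2\<close> stays below \<open>s^2\<close>, hence below \<open>2 * n\<close>.\<close>
  also have "\<dots> < (2 ^ (s - 2)) ^ (s + 2)"
    using sixth_power_less_two_power[OF \<open>s \<ge> 36\<close>] by (intro power_strict_mono) auto
  also have "\<dots> = 2 ^ ((s - 2) * (s + 2))" by (simp only: power_mult)
  also have "\<dots> \<le> 2 ^ (2 * n)"
  proof (rule power_increasing)
    have "(s - 2) * (s + 2) \<le> s\<^sup>2"
      using \<open>s \<ge> 36\<close> by (simp add: algebra_simps power2_eq_square)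
    then show "(s - 2) * (s + 2) \<le> 2 * n" using s(1) by linarith
  qed simp
  also have "\<dots> = 4 ^ n" by (simp add: power_mult)
  finally show False by simp
qed

lemma prime_nat_trial_division:
  fixes p b :: nat
  assumes "1 < p" "p < b * b" "\<forall>d\<in>set [2..<b]. \<not> d dvd p"
  shows "prime p"
proof (rule ccontr)
  assume "\<not> prime p"
  then obtain m where "m dvd p" "m \<noteq> 1" "m \<noteq> p"
    using assms(1) by (auto simp: prime_nat_iff)
  then obtain k where k: "p = m * k" "k \<noteq> 1" by (auto elim!: dvdE)
  then have "m \<noteq> 0" "k \<noteq> 0" using assms(1) by (cases "m = 0"; cases "k = 0"; simp)+
  with k \<open>m \<noteq> 1\<close> have mk: "p = m * k" "1 < m" "1 < k" by auto
  have "m < b \<or> k < b"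
  proof (rule ccontr)
    assume "\<not> ?thesis"
    then have "b * b \<le> m * k" by (intro mult_le_mono) auto
    then show False using assms(2) mk(1) by simp
  qed
  moreover have "\<not> d dvd p" if "1 < d" "d < b" for d using assms(3) that by simp
  moreover have "m dvd p" "k dvd p" using mk(1) by simp_all
  ultimately show False using mk(2,3) by blast
qed

text \<open>The extra 1 is needed for small \<open>n\<close>: \<open>(1, 2]\<close> and
  \<open>(3, 6]\<close> hold only one prime each.\<close>

lemma two_primes_gt_le_double_Suc:
  fixes n :: nat
  assumes "n \<ge> 1"
  shows "\<exists>y z. prime y \<and> prime z \<and> n < y \<and> y < z \<and> z \<le> 2 * n + 1"
proof -
  \<comment> \<open>Below 648, a chain of primes in which each term is at most one more than twice the term two
    places before it suffices.\<close>
  have step: ?thesis if "a \<le> n" "n < y" "y < z" "z \<le> 2 * a + 1" "prime y" "prime z" for a y z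
    using that by (intro exI[of _ y] exI[of _ z]) auto
  have primes: "prime (2::nat)" "prime (3::nat)" "prime (5::nat)" "prime (7::nat)"
    "prime (11::nat)" "prime (13::nat)" "prime (19::nat)" "prime (23::nat)"
    by simp_all
  \<comment> \<open>\<open>34 * 34 = 1156\<close> exceeds 1093, so divisors below 34 suffice; each
    prime here is above 33 and is not tested against itself.\<close>
  have primes': "prime (37::nat)" "prime (47::nat)" "prime (73::nat)" "prime (89::nat)"
    "prime (139::nat)" "prime (179::nat)" "prime (277::nat)" "prime (359::nat)" "prime (547::nat)"
    "prime (719::nat)" "prime (1093::nat)"
    by (rule prime_nat_trial_division[where b = 34]; simp)+
  consider "n < 2" | "\<not> n < 2" "n < 3" | "\<not> n < 3" "n < 5" | "\<not> n < 5" "n < 7"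
    | "\<not> n < 7" "n < 11" | "\<not> n < 11" "n < 13" | "\<not> n < 13" "n < 19"
    | "\<not> n < 19" "n < 23" | "\<not> n < 23" "n < 37" | "\<not> n < 37" "n < 47"
    | "\<not> n < 47" "n < 73" | "\<not> n < 73" "n < 89" | "\<not> n < 89" "n < 139"
    | "\<not> n < 139" "n < 179" | "\<not> n < 179" "n < 277" | "\<not> n < 277" "n < 359"
    | "\<not> n < 359" "n < 547" | "\<not> n < 547" "n < 719" | "\<not> n < 719"
    by blast
  then show ?thesis
  proof cases
    case 1
    with assms show ?thesis by (intro step[OF _ _ _ _ primes(1) primes(2), of 1]) auto
  next
    case 2
    with assms show ?thesis by (intro step[OF _ _ _ _ primes(2) primes(3), of 2]) auto
  next
    case 3
    with assms show ?thesis by (intro step[OF _ _ _ _ primes(3) primes(4), of 3]) auto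
  next
    case 4
    with assms show ?thesis by (intro step[OF _ _ _ _ primes(4) primes(5), of 5]) auto
  next
    case 5
    with assms show ?thesis by (intro step[OF _ _ _ _ primes(5) primes(6), of 7]) auto
  next
    case 6
    with assms show ?thesis by (intro step[OF _ _ _ _ primes(6) primes(7), of 11]) auto
  next
    case 7
    with assms show ?thesis by (intro step[OF _ _ _ _ primes(7) primes(8), of 13]) auto
  next
    case 8
    with assms show ?thesis by (intro step[OF _ _ _ _ primes(8) primes'(1), of 19]) auto
  next
    case 9
    with assms show ?thesis by (intro step[OF _ _ _ _ primes'(1) primes'(2), of 23]) auto
  next
    case 10
    with assms show ?thesis by (intro step[OF _ _ _ _ primes'(2) primes'(3), of 37]) auto
  next
    case 11
    with assms show ?thesis by (intro step[OF _ _ _ _ primes'(3) primes'(4), of 47]) auto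
  next
    case 12
    with assms show ?thesis by (intro step[OF _ _ _ _ primes'(4) primes'(5), of 73]) auto
  next
    case 13
    with assms show ?thesis by (intro step[OF _ _ _ _ primes'(5) primes'(6), of 89]) auto
  next
    case 14
    with assms show ?thesis by (intro step[OF _ _ _ _ primes'(6) primes'(7), of 139]) auto
  next
    case 15
    with assms show ?thesis by (intro step[OF _ _ _ _ primes'(7) primes'(8), of 179]) auto
  next
    case 16
    with assms show ?thesis by (intro step[OF _ _ _ _ primes'(8) primes'(9), of 277]) auto
  next
    case 17
    with assms show ?thesis by (intro step[OF _ _ _ _ primes'(9) primes'(10), of 359]) auto
  next
    case 18
    with assms show ?thesis by (intro step[OF _ _ _ _ primes'(10) primes'(11), of 547]) auto
  next
    case 19
    let ?P = "{p. prime p \<and> n < p \<and> p \<le> 2 * n}"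
    have "\<not> card ?P \<le> Suc 0"
      using card_primes_gt_le_double[of n] 19 by simp
    then obtain u v where "u \<in> ?P" "v \<in> ?P" "u \<noteq> v"
      by (subst (asm) card_le_Suc0_iff_eq) auto
    then show ?thesis
      by (intro exI[of _ "min u v"] exI[of _ "max u v"]) (auto simp: min_def max_def)
  qed
qed

subsection \<open>The function S and the set F\<close>

text \<open>Evaluates \<open>S\<close> on an explicit factorization; positive exponents make
  \<open>A\<close> exactly the set of prime factors.\<close>

lemma S_prod_prime_powers:
  assumes "finite A" "\<And>q. q \<in> A \<Longrightarrow> prime q" "\<And>q. q \<in> A \<Longrightarrow> f q > 0"
  shows "S r (\<Prod>q\<in>A. q ^ f q) = (\<Prod>q\<in>A. if q \<le> r then 0 else q ^ (f q - 1) * (q - r))"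
proof -
  have mult: "multiplicity q (\<Prod>q\<in>A. q ^ f q) = (if q \<in> A then f q else 0)" if "prime q" for q
    using multiplicity_prod_prime_powers[OF assms(1,2) that] by simp
  have "prime_factors (\<Prod>q\<in>A. q ^ f q) = A"
    using assms(2,3) by (auto simp: prime_factors_multiplicity mult split: if_splits)
  then show ?thesis
    unfolding S_def using assms(2) by (intro prod.cong) (auto simp: mult)
qed

lemma not_mem_F_I:
  assumes "m > n" "S r m > 0" "S r m \<le> S r n"
  shows "n \<notin> F r"
  using assms unfolding F_def B_def by fastforce

text \<open>Trading one \<open>q\<close> for \<open>z\<close> replaces a factor \<open>q\<close> of
  the value by \<open>z - r\<close>. Both the square (\<open>k = 0\<close>) and the cube
  (\<open>k = 1\<close>) are covered.\<close>

lemma prime_power_not_mem_F_if_next_prime_near: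
  assumes "prime q" "r < q" "prime z" "q < z" "z \<le> q + r"
  shows "q ^ (k + 2) \<notin> F r"
proof (rule not_mem_F_I)
  let ?f = "\<lambda>x. if x = q then k + 1 else 1"
  show "q ^ (k + 1) * z > q ^ (k + 2)"
    using assms by simp
  have "S r (\<Prod>x\<in>{q, z}. x ^ ?f x) =
      (\<Prod>x\<in>{q, z}. if x \<le> r then 0 else x ^ (?f x - 1) * (x - r))"
    using assms by (intro S_prod_prime_powers) auto
  then have "S r (q ^ (k + 1) * z) = q ^ k * (q - r) * (z - r)"
    using assms by simp
  moreover have "S r (q ^ (k + 2)) = q ^ (k + 1) * (q - r)"
    using S_prod_prime_powers[of "{q}" "\<lambda>_. k + 2" r] assms by simp
  moreover have "q ^ k * (q - r) * (z - r) \<le> q ^ k * (q - r) * q"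
    using assms by (intro mult_le_mono2) auto
  ultimately show "S r (q ^ (k + 1) * z) > 0" "S r (q ^ (k + 1) * z) \<le> S r (q ^ (k + 2))"
    using assms by (simp_all add: ac_simps)
qed

lemma prime_cube_not_mem_F:
  assumes "r \<ge> 1" "prime p" "r < p" "prime q" "r < q" "q < p" "q \<le> 2 * r"
  shows "p ^ 3 \<notin> F r"
proof -
  define n where "n = p\<^sup>2 div q"
  have "q * q \<le> p\<^sup>2" unfolding power2_eq_square using assms by (intro mult_le_mono) auto
  then have "n \<ge> 1"
    using assms div_le_mono[of "q * q" "p\<^sup>2" q] by (simp add: n_def)
  \<comment> \<open>The smaller of the two primes in \<open>(n, 2 * n + 1]\<close> is at most
    \<open>2 * n\<close>.\<close>
  then obtain y where y: "prime y" "n < y" "y \<le> 2 * n"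
    using two_primes_gt_le_double_Suc[of n] by fastforce
  have qn: "q * n \<le> p\<^sup>2" by (simp add: n_def)
  have "p\<^sup>2 < q * Suc n"
    using assms dividend_less_times_div[of q "p\<^sup>2"] by (simp add: n_def)
  also have "\<dots> \<le> q * y" using y by (intro mult_le_mono2) auto
  finally have qy: "p\<^sup>2 < q * y" .
  \<comment> \<open>This makes \<open>q\<close>, \<open>p\<close>, \<open>y\<close> distinct, so
    \<open>S\<close> can be evaluated on their product factor by factor.\<close>
  have "p < y"
  proof (rule ccontr)
    assume "\<not> p < y"
    then have "q * y \<le> p * p" using assms by (intro mult_le_mono) auto
    then show False using qy by (simp add: power2_eq_square)
  qed
  have "(q - r) * (y - r) \<le> (q - r) * (2 * n)" using y by (intro mult_le_mono2) auto
  also have "\<dots> = (2 * (q - r)) * n" by simp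
  also have "\<dots> \<le> q * n" using assms by (intro mult_le_mono1) auto
  finally have le: "(q - r) * (y - r) \<le> p\<^sup>2" using qn by simp
  have Sm: "S r (q * p * y) = (q - r) * (p - r) * (y - r)"
  proof -
    have "S r (\<Prod>x\<in>{q, p, y}. x ^ 1) =
        (\<Prod>x\<in>{q, p, y}. if x \<le> r then 0 else x ^ (1 - 1) * (x - r))"
      using assms y by (intro S_prod_prime_powers) auto
    then show ?thesis
      using assms \<open>p < y\<close> by (simp add: mult.assoc)
  qed
  have Sp: "S r (p ^ 3) = p\<^sup>2 * (p - r)"
    using S_prod_prime_powers[of "{p}" "\<lambda>_. 3" r] assms by simp
  show ?thesis
  proof (rule not_mem_F_I)
    show "p ^ 3 < q * p * y"
      using qy assms by (simp add: power3_eq_cube power2_eq_square algebra_simps)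
    show "S r (q * p * y) > 0" using assms \<open>p < y\<close> by (simp add: Sm)
    show "S r (q * p * y) \<le> S r (p ^ 3)"
      using mult_le_mono1[OF le, of "p - r"] unfolding Sm Sp by (simp only: ac_simps)
  qed
qed

subsection \<open>The least prime exceeding r\<close>

lemma card_primes_le_next_prime:
  fixes x :: nat
  defines "q \<equiv> (LEAST q. prime q \<and> x < q)"
  shows "prime q" "x < q" "card {p. prime p \<and> p \<le> q} = Suc (card {p. prime p \<and> p \<le> x})"
proof -
  show q: "prime q" "x < q"
    using LeastI_ex[OF bigger_prime[of x]] by (auto simp: q_def)
  have "\<not> (prime p \<and> x < p)" if "p < q" for p
    using that not_less_Least unfolding q_def by blast
  then have "{p. prime p \<and> p \<le> q} = insert q {p. prime p \<and> p \<le> x}"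
    using q by (auto simp: order_le_less) (metis linorder_neqE_nat)
  then show "card {p. prime p \<and> p \<le> q} = Suc (card {p. prime p \<and> p \<le> x})"
    using q by simp
qed

lemma card_primes_le_strict_mono:
  fixes x p :: nat
  assumes "prime p" "x < p"
  shows "card {q. prime q \<and> q \<le> x} < card {q. prime q \<and> q \<le> p}"
proof (rule psubset_card_mono)
  have "p \<in> {q. prime q \<and> q \<le> p}" "p \<notin> {q. prime q \<and> q \<le> x}" using assms by auto
  moreover have "{q. prime q \<and> q \<le> x} \<subseteq> {q. prime q \<and> q \<le> p}" using assms by auto
  ultimately show "{q. prime q \<and> q \<le> x} \<subset> {q. prime q \<and> q \<le> p}" by blast
qed simp

text \<open>The count of primes up to a prime determines that prime, so \<open>LEAST\<close> selects
  the only candidate.\<close>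

lemma nth_prime1_eqI:
  assumes "prime p" "card {q. prime q \<and> q \<le> p} = i"
  shows "nth_prime1 i = p"
  unfolding nth_prime1_def
proof (rule Least_equality)
  fix p' :: nat assume "prime p' \<and> card {q. prime q \<and> q \<le> p'} = i"
  then show "p \<le> p'"
    using card_primes_le_strict_mono[OF assms(1), of p'] assms(2) by (metis less_irrefl not_le)
qed (use assms in simp)

lemma nth_prime1:
  assumes "i \<ge> 1"
  shows "prime (nth_prime1 i)" "card {q. prime q \<and> q \<le> nth_prime1 i} = i"
proof -
  have ex: "\<exists>x::nat. card {q. prime q \<and> q \<le> x} = j" for j
  proof (induction j)
    case 0
    have "{q. prime q \<and> q \<le> (0::nat)} = {}" by auto
    then show ?case by (metis card.empty)
  next
    case (Suc j)
    then show ?case using card_primes_le_next_prime(3) by metis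
  qed
  obtain x :: nat where "card {q. prime q \<and> q \<le> x} = i - 1" using ex by blast
  then have next_prime: "card {q. prime q \<and> q \<le> (LEAST q. prime q \<and> x < q)} = i"
    using card_primes_le_next_prime(3)[of x] assms by simp
  then have "nth_prime1 i = (LEAST q. prime q \<and> x < q)"
    by (intro nth_prime1_eqI card_primes_le_next_prime(1))
  then show "prime (nth_prime1 i)" "card {q. prime q \<and> q \<le> nth_prime1 i} = i"
    using next_prime card_primes_le_next_prime(1)[of x] by simp_all
qed

text \<open>Identifies \<open>b\<close> with the prime-counting function, turning statements about
  indices into statements about counts.\<close>

lemma b_eq_card_primes_le:
  assumes "r \<ge> 1"
  shows "b r = card {q. prime q \<and> q \<le> r}"
proof (cases "r = 1")
  case True
  have "{q. prime q \<and> q \<le> (1::nat)} = {}" by (auto dest!: prime_gt_1_nat)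
  then have "card {q. prime q \<and> q \<le> (1::nat)} = 0" by (simp only: card.empty)
  then show ?thesis using True by (simp add: b_def)
next
  case False
  let ?c = "card {q. prime q \<and> q \<le> r}"
  \<comment> \<open>The prime 2 gives \<open>?c\<close> the positivity required under
    \<open>GREATEST\<close>.\<close>
  have "card {2::nat} \<le> ?c" using False assms by (intro card_mono) auto
  then have c: "?c \<ge> 1" by simp
  have "(GREATEST k. k \<ge> 1 \<and> nth_prime1 k \<le> r) = ?c"
  proof (rule Greatest_equality)
    have "\<not> r < nth_prime1 ?c"
      using card_primes_le_strict_mono[OF nth_prime1(1)[OF c], of r] nth_prime1(2)[OF c] by auto
    then show "?c \<ge> 1 \<and> nth_prime1 ?c \<le> r" using c by simp
  next
    fix k assume k: "k \<ge> 1 \<and> nth_prime1 k \<le> r"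
    then have "card {q. prime q \<and> q \<le> nth_prime1 k} \<le> ?c"
      by (intro card_mono) auto
    then show "k \<le> ?c" using nth_prime1(2)[of k] k by simp
  qed
  then show ?thesis using False by (simp add: b_def)
qed

lemma nth_prime1_b_Suc:
  assumes "r \<ge> 1"
  shows "nth_prime1 (b r + 1) = (LEAST q. prime q \<and> r < q)"
  using card_primes_le_next_prime[of r] b_eq_card_primes_le[OF assms]
  by (intro nth_prime1_eqI) auto

theorem theorem3p2:
  fixes r p :: nat
  assumes "r \<ge> 1" and "prime p"
  shows "(nth_prime1 (b r + 1))^2 \<notin> F r \<and> p^3 \<notin> F r"
proof -
  define q where "q = (LEAST q. prime q \<and> r < q)"
  have q: "prime q" "r < q"
    using card_primes_le_next_prime[of r] by (auto simp: q_def)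
  have q_le: "q \<le> x" if "prime x" "r < x" for x
    unfolding q_def using that by (intro Least_le) auto
  obtain y z where yz: "prime y" "prime z" "r < y" "y < z" "z \<le> 2 * r + 1"
    using two_primes_gt_le_double_Suc[OF assms(1)] by blast
  \<comment> \<open>Since \<open>y < z\<close>, this yields \<open>q \<le> 2 * r\<close>; since
    \<open>r < q\<close>, also \<open>z \<le> 2 * r + 1 \<le> q + r\<close>.\<close>
  then have "q \<le> y" using q_le by simp
  then have near: "q ^ (k + 2) \<notin> F r" for k
    using prime_power_not_mem_F_if_next_prime_near[OF q yz(2)] yz q by auto
  have "(nth_prime1 (b r + 1))\<^sup>2 \<notin> F r"
    using near[of 0] nth_prime1_b_Suc[OF assms(1)] unfolding q_def by (metis add_0)
  moreover have "p ^ 3 \<notin> F r"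
  proof -
    consider "p \<le> r" | "p = q" | "r < p" "q < p"
      using q_le[OF assms(2)] by linarith
    then show ?thesis
    proof cases
      case 1
      \<comment> \<open>Here the cube already lies outside \<open>B r\<close>.\<close>
      then have "S r (p ^ 3) = 0"
        using S_prod_prime_powers[of "{p}" "\<lambda>_. 3" r] assms by simp
      then show ?thesis by (simp add: F_def B_def)
    next
      case 2
      then show ?thesis using near[of 1] by (simp add: numeral_3_eq_3)
    next
      case 3
      then show ?thesis
        using prime_cube_not_mem_F[OF assms 3(1) q 3(2)] \<open>q \<le> y\<close> yz by simp
    qed
  qed
  ultimately show ?thesis ..
qed

end
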